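(* Let $k\ge 1$ and $n\ge 0$ be integers, let $A$ be a set of positive integers, and let $c=(c_a)_{a\ge 1}$ be a sequence of nonnegative integers such that $c_a=0$ exactly when $a\notin A$. The $(k+1)$-tuple of statistics $(\mathrm{wpk}_0,\mathrm{wpk}_1,\dots,\mathrm{wpk}_{k-1},\mathrm{wdd})$ on the set $\mathcal{P}^{k,A,c}_n$ of $(k,A,c)$-paths of length $n$ is jointly equidistributed with any of its permutations. That is, writing $(s_0,\dots,s_k)=(\mathrm{wpk}_0,\dots,\mathrm{wpk}_{k-1},\mathrm{wdd})$, for every permutation $\sigma$ of $\{0,1,\dots,k\}$ and all nonnegative integers $r_0,\dots,r_k$, the number of $P\in\mathcal{P}^{k,A,c}_n$ with $s_i(P)=r_i$ for all $i$ equals the number of $P\in\mathcal{P}^{k,A,c}_n$ with $s_{\sigma(i)}(P)=r_i$ for all $i$.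
   Context: A $(k,A,c)$-path is a lattice path starting at $(0,0)$, ending at height $0$, and staying in the first quadrant (never going below the $x$-axis), with steps $u=(1,1)$ (up-step), $d=(1,-k)$ (down-step) and, for each $a\in A$ and each color $b$ with $1\le b\le c_a$, a level step $l_{a,b}=(a,0)$ of color $b$ (no level steps if $A=\emptyset$). Level steps with different $(a,b)$ are distinct, and paths are identified with their step sequences. Step lengths are $|u|=1$, $|d|=1$, $|l_{a,b}|=a$, and the length $|P|$ of a path $P$ is the sum of the lengths of its steps. $\mathcal{P}^{k,A,c}_n$ is the set of $(k,A,c)$-paths of length $n$. In such a path $P$, a weak double descent is a block of two consecutive steps of the form $dd$ or $l_{a,b}d$. A weak peak is a block of two consecutive steps of the form $ud$ or $ul_{a,b}$, or the single step $l_{a,b}$ if it is the leftmost (first) step of $P$. (Here $a\in A$, $1\le b\le c_a$.) The height of a weak peak is the second coordinate of the left endpoint of its down-step or level step. For $0\le i\le k-1$, $\mathrm{wpk}_i(P)$ is the number of non-rightmost weak peaks of $P$ (all weak peaks except the last one) whose height is congruent to $i$ modulo $k$; $\mathrm{wdd}(P)$ is the number of weak double descents of $P$. All statistics are $0$ on the empty path. *)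

theory Defs
  imports "HOL-Combinatorics.Permutations" "HOL-Number_Theory.Cong" "HOL-Library.Product_Plus"
begin

datatype step = U | D | L nat nat

fun step_vec :: "nat \<Rightarrow> step \<Rightarrow> int \<times> int" where
  "step_vec k U = (1, 1)"
| "step_vec k D = (1, - int k)"
| "step_vec k (L a b) = (int a, 0)"

fun step_len :: "step \<Rightarrow> nat" where
  "step_len U = 1"
| "step_len D = 1"
| "step_len (L a b) = a"

definition steps :: "nat set \<Rightarrow> (nat \<Rightarrow> nat) \<Rightarrow> step set" where
  "steps A c = {U, D} \<union> {L a b | a b. a \<in> A \<and> 1 \<le> b \<and> b \<le> c a}"

text \<open>The lattice point reached after the first \<open>i\<close> steps of a path started at the origin; it is
  the left endpoint of the step \<open>P ! i\<close> when \<open>i < length P\<close>.\<close>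

definition vertex :: "nat \<Rightarrow> step list \<Rightarrow> nat \<Rightarrow> int \<times> int" where
  "vertex k P i = sum_list (map (step_vec k) (take i P))"

definition height :: "nat \<Rightarrow> step list \<Rightarrow> nat \<Rightarrow> int" where
  "height k P i = snd (vertex k P i)"

definition path_len :: "step list \<Rightarrow> nat" where
  "path_len P = sum_list (map step_len P)"

text \<open>Since the first quadrant is convex, it suffices to constrain the vertices of a path.\<close>

definition is_path :: "nat \<Rightarrow> nat set \<Rightarrow> (nat \<Rightarrow> nat) \<Rightarrow> step list \<Rightarrow> bool" where
  "is_path k A c P \<longleftrightarrow> set P \<subseteq> steps A c \<and> height k P (length P) = 0 \<and>
     (\<forall>i \<le> length P. 0 \<le> fst (vertex k P i) \<and> 0 \<le> snd (vertex k P i))"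

definition paths :: "nat \<Rightarrow> nat set \<Rightarrow> (nat \<Rightarrow> nat) \<Rightarrow> nat \<Rightarrow> step list set" where
  "paths k A c n = {P. is_path k A c P \<and> path_len P = n}"

fun is_level :: "step \<Rightarrow> bool" where
  "is_level (L a b) = True"
| "is_level _ = False"

definition wdd :: "step list \<Rightarrow> nat" where
  "wdd P = card {i. Suc i < length P \<and> (P ! i = D \<or> is_level (P ! i)) \<and> P ! Suc i = D}"

text \<open>A weak peak is represented by the position of its down-step or level step.\<close>

definition weak_peaks :: "step list \<Rightarrow> nat set" where
  "weak_peaks P =
     {Suc i | i. Suc i < length P \<and> P ! i = U \<and> (P ! Suc i = D \<or> is_level (P ! Suc i))} \<union>
     {i. i = 0 \<and> P \<noteq> [] \<and> is_level (P ! 0)}"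

definition wpk :: "nat \<Rightarrow> nat \<Rightarrow> step list \<Rightarrow> nat" where
  "wpk k i P = card {j \<in> weak_peaks P. (\<exists>j' \<in> weak_peaks P. j < j') \<and>
                                        [height k P j = int i] (mod int k)}"

definition stat :: "nat \<Rightarrow> nat \<Rightarrow> step list \<Rightarrow> nat" where
  "stat k i P = (if i < k then wpk k i P else wdd P)"

text \<open>There are finitely many paths of each length, even for infinite \<open>A\<close>, so that counting them
  with \<^const>\<open>card\<close> is meaningful.\<close>

lemma finite_paths:
  assumes "\<forall>a\<in>A. 0 < a"
  shows "finite (paths k A c n)"
proof -
  let ?S = "{U, D} \<union> (\<lambda>(a, b). L a b) ` (SIGMA a:{..n}. {..c a})"
  have len: "step_len s \<ge> 1" if "s \<in> steps A c" for s
    using that assms by (auto simp: steps_def Suc_le_eq)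
  have le: "length P \<le> path_len P" if "set P \<subseteq> steps A c" for P
    using that by (induction P) (use len in \<open>force simp: path_len_def\<close>)+
  have mem: "step_len s \<le> path_len P" if "s \<in> set P" for s P
    unfolding path_len_def using that by (intro member_le_sum_list) auto
  have "paths k A c n \<subseteq> {P. set P \<subseteq> ?S \<and> length P \<le> n}"
  proof
    fix P assume "P \<in> paths k A c n"
    then have P: "set P \<subseteq> steps A c" "path_len P = n"
      by (auto simp: paths_def is_path_def)
    have "s \<in> ?S" if "s \<in> set P" for s
      using that P mem[OF that] by (cases s) (force simp: steps_def)+
    with P le[OF P(1)] show "P \<in> {P. set P \<subseteq> ?S \<and> length P \<le> n}" by auto
  qed
  moreover have "finite {P. set P \<subseteq> ?S \<and> length P \<le> n}"
    by (intro finite_lists_length_le) auto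
  ultimately show ?thesis by (rule finite_subset)
qed

end

theory Submission
  imports Defs
begin

text \<open>A nonempty path either is \<open>P\<^sub>0 l\<close> with a level step \<open>l\<close>, or it ends in a down-step and then
factors uniquely as \<open>P\<^sub>0 u P\<^sub>1 u \<dots> u P\<^sub>k d\<close>, where the displayed up-steps are the last ones to leave
the heights \<open>0, \<dots>, k - 1\<close> and each \<open>P\<^sub>i\<close> is a path raised by \<open>i\<close>. Iterating this turns paths into
trees whose inner nodes are unary (level steps) or have \<open>k + 1\<close> ordered children (down-steps);
see \<open>word_bij_betw\<close>.

Let \<open>s(P)\<close> be the vector \<open>(wpk\<^sub>0, \<dots>, wpk\<^bsub>k-1\<^esub>, wdd)\<close>. By induction, the rightmost weak peak of a
nonempty path has height \<open>0\<close> modulo \<open>k\<close> (\<open>last_peak_flat\<close>). Hence, on forming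
\<open>P\<^sub>0 u P\<^sub>1 u \<dots> u P\<^sub>k d\<close>, a nonempty \<open>P\<^sub>i\<close> with \<open>i < k\<close> contributes its formerly rightmost weak peak
to \<open>wpk\<^sub>i\<close>, whereas a nonempty \<open>P\<^sub>k\<close> keeps the rightmost weak peak of the whole but creates a weak
double descent with the final \<open>d\<close>. With \<open>\<rho>\<close> the cyclic shift of the first \<open>k\<close> coordinates and \<open>e\<^sub>i\<close>
the unit vectors, this reads
\<open>s(P) = (\<Sum>i\<le>k. \<rho>\<^sup>i s(P\<^sub>i) + [P\<^sub>i nonempty] e\<^sub>i)\<close>, while \<open>s(P\<^sub>0 l) = s(P\<^sub>0)\<close>; see \<open>stat_word\<close>.

This recursion treats all \<open>k + 1\<close> coordinates alike, up to the shifts. So for a permutation \<open>p\<close> of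
the coordinates there is a recursively defined bijection \<open>\<Phi>\<^sub>p\<close> (\<open>perm_tree\<close>) that acts on \<open>s\<close> as \<open>p\<close>:
the child at position \<open>i\<close> is moved to position \<open>p i\<close>, after applying to it \<open>\<Phi>\<^sub>q\<close> with
\<open>q = \<rho>\<^bsup>-p(i)\<^esup> p \<rho>\<^sup>i\<close>, which makes up for the two shifts (\<open>tstat_perm_tree\<close>). Its inverse is \<open>\<Phi>\<close> of the
inverse permutation (\<open>perm_tree_inverse\<close>), and it only permutes the steps of the path
(\<open>mset_uword_perm_tree\<close>), so that it preserves the length and the available level steps.\<close>

section \<open>Trees and the paths that they encode\<close>

text \<open>\<open>Empty\<close> is the empty path, \<open>Level t a b\<close> the path of \<open>t\<close> followed by the level step \<open>L a b\<close>, and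
\<open>Node [t\<^sub>0, \<dots>, t\<^sub>k]\<close> the path \<open>P\<^sub>0 u P\<^sub>1 u \<dots> u P\<^sub>k d\<close>. The number of children is not part of the type;
it is imposed by \<open>full\<close>.\<close>

datatype ptree = Empty | Level ptree nat nat | Node "ptree list"

fun full :: "nat \<Rightarrow> ptree \<Rightarrow> bool" where
  "full k Empty = True"
| "full k (Level t a b) = full k t"
| "full k (Node ts) = (length ts = Suc k \<and> (\<forall>t\<in>set ts. full k t))"

text \<open>The path of a tree with an extra up-step in front. This makes every path, the empty one
included, begin with \<open>U\<close>, so that concatenation alone puts the up-steps between the children of a
node, and an initial level step of the path is preceded by an up-step like any other weak peak.\<close>

fun uword :: "ptree \<Rightarrow> step list" where
  "uword Empty = [U]"
| "uword (Level t a b) = uword t @ [L a b]"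
| "uword (Node ts) = concat (map uword ts) @ [D]"

text \<open>A list \<open>[t\<^sub>0, \<dots>, t\<^sub>h]\<close> encodes the path prefix \<open>P\<^sub>0 u P\<^sub>1 u \<dots> u P\<^sub>h\<close>, which ends at height \<open>h\<close>. Such lists
are the states of a parser that reads a path from left to right: an up-step pushes \<open>Empty\<close>, a
level step acts on the last tree, and a down-step joins the last \<open>k + 1\<close> trees into one node.\<close>

definition flat :: "ptree list \<Rightarrow> step list" where
  "flat ts = tl (concat (map uword ts))"

definition word :: "ptree \<Rightarrow> step list" where
  "word t = flat [t]"

lemma uword_neq_Nil [simp]: "uword t \<noteq> []"
  by (cases t) auto

text \<open>Induction along the parser: each case undoes the last step of the encoded path prefix.\<close>

lemma full_stack_induct [consumes 2, case_names single push level node]: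
  assumes "ts \<noteq> []" and "\<forall>t\<in>set ts. full k t"
    and single: "Q [Empty]"
    and push: "\<And>ts. ts \<noteq> [] \<Longrightarrow> \<forall>t\<in>set ts. full k t \<Longrightarrow> Q ts \<Longrightarrow> Q (ts @ [Empty])"
    and level: "\<And>ts t a b. \<forall>t\<in>set (ts @ [t]). full k t \<Longrightarrow> Q (ts @ [t]) \<Longrightarrow> Q (ts @ [Level t a b])"
    and node: "\<And>ts us. \<forall>t\<in>set (ts @ us). full k t \<Longrightarrow> length us = Suc k \<Longrightarrow> Q (ts @ us) \<Longrightarrow>
                 Q (ts @ [Node us])"
  shows "Q ts"
  using assms(1,2)
proof (induction "length (concat (map uword ts))" arbitrary: ts rule: less_induct)
  case less
  obtain us t where ts: "ts = us @ [t]"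
    using less.prems(1) by (metis append_butlast_last_id)
  show ?case
  proof (cases t)
    case Empty
    show ?thesis
    proof (cases "us = []")
      case False
      then show ?thesis
        using less.hyps[of us] less.prems Empty ts push[of us] by simp
    qed (use Empty ts single in simp)
  next
    case (Level t' a b)
    then show ?thesis
      using less.hyps[of "us @ [t']"] less.prems ts level[of us t'] by simp
  next
    case (Node vs)
    have "length (concat (map uword (us @ vs))) < length (concat (map uword ts))"
      using ts Node by simp
    moreover have "us @ vs \<noteq> []" "\<forall>t\<in>set (us @ vs). full k t" "length vs = Suc k"
      using less.prems ts Node by auto
    ultimately show ?thesis
      using less.hyps[of "us @ vs"] ts Node node[of us vs] by simp
  qed
qed

lemma Cons_flat:
  assumes "ts \<noteq> []" and "\<forall>t\<in>set ts. full k t"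
  shows "concat (map uword ts) = U # flat ts"
proof -
  from assms have "\<exists>w. concat (map uword ts) = U # w"
    by (induction rule: full_stack_induct) (auto simp flip: append_assoc)
  then show ?thesis by (auto simp: flat_def)
qed

lemma uword_eq_Cons_word: "full k t \<Longrightarrow> uword t = U # word t"
  using Cons_flat[of "[t]" k] by (simp add: word_def)

lemma flat_single: "flat [Empty] = []"
  by (simp add: flat_def)

lemma flat_push: "ts \<noteq> [] \<Longrightarrow> flat (ts @ [Empty]) = flat ts @ [U]"
  by (cases ts) (auto simp: flat_def)

lemma flat_level: "flat (ts @ [Level t a b]) = flat (ts @ [t]) @ [L a b]"
  by (cases ts) (auto simp: flat_def)

lemma flat_node: "us \<noteq> [] \<Longrightarrow> flat (ts @ [Node us]) = flat (ts @ us) @ [D]"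
  by (cases ts; cases us) (auto simp: flat_def)

lemma last_uword: "last (uword t) = U \<longleftrightarrow> t = Empty"
  by (cases t) auto

text \<open>Whether a new step completes a weak peak or a weak double descent depends only on whether the
step before it is an up-step. Prepending \<open>U\<close> covers the empty prefix as well.\<close>

lemma last_flat:
  assumes "ts \<noteq> []" and "\<forall>t\<in>set ts. full k t"
  shows "last (U # flat ts) = U \<longleftrightarrow> last ts = Empty"
proof -
  obtain us t where "ts = us @ [t]"
    using assms(1) by (metis append_butlast_last_id)
  then have "last (concat (map uword ts)) = U \<longleftrightarrow> last ts = Empty"
    using last_uword[of t] by simp
  then show ?thesis
    by (simp only: Cons_flat[OF assms])
qed

lemma uword_last_cases:
  assumes "ts \<noteq> []"
  obtains "ts = butlast ts @ [Empty]" "concat (map uword ts) = concat (map uword (butlast ts)) @ [U]"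
  | t a b where "ts = butlast ts @ [Level t a b]"
      "concat (map uword ts) = concat (map uword (butlast ts @ [t])) @ [L a b]"
  | us where "ts = butlast ts @ [Node us]"
      "concat (map uword ts) = concat (map uword (butlast ts @ us)) @ [D]"
proof -
  obtain us t where "ts = us @ [t]"
    using assms by (metis append_butlast_last_id)
  then show ?thesis
    using that by (cases t) auto
qed

text \<open>Unique readability: the last letter determines the kind of the last tree, and for a node the
known number of children tells where its children start.\<close>

lemma concat_uword_inj:
  assumes "\<forall>t\<in>set ts. full k t" and "\<forall>t\<in>set us. full k t"
    and "concat (map uword ts) = concat (map uword us)"
  shows "ts = us"
  using assms
proof (induction "length (concat (map uword ts))" arbitrary: ts us rule: less_induct)
  case less
  show ?case
  proof (cases "ts = [] \<or> us = []")
    case True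
    then show ?thesis using less.prems(3)
      by (metis concat_eq_Nil_conv list.map_disc_iff list.set_intros(1) list.exhaust uword_neq_Nil
            list.simps(9) concat.simps(1))
  next
    case False
    then have ne: "ts \<noteq> []" "us \<noteq> []" by auto
    have full_ts: "full k t" if "t \<in> set (butlast ts)" for t
      using that less.prems(1) by (meson in_set_butlastD)
    have full_us: "full k t" if "t \<in> set (butlast us)" for t
      using that less.prems(2) by (meson in_set_butlastD)
    from ne(1) show ?thesis
    proof (cases ts rule: uword_last_cases)
      case 1
      with ne(2) less.prems(3) have u: "us = butlast us @ [Empty]"
        "concat (map uword (butlast ts)) = concat (map uword (butlast us))"
        by (cases us rule: uword_last_cases; simp)+
      have "butlast ts = butlast us"
        by (rule less.hyps) (use 1 u full_ts full_us in auto)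
      then show ?thesis using 1 u by simp
    next
      case (2 t a b)
      with ne(2) less.prems(3) obtain t' where u: "us = butlast us @ [Level t' a b]"
        "concat (map uword (butlast ts @ [t])) = concat (map uword (butlast us @ [t']))"
        by (cases us rule: uword_last_cases) auto
      have "full k t" "full k t'"
        using less.prems(1,2) 2(1) u(1)
        by (metis full.simps(2) in_set_conv_decomp)+
      moreover have lt: "length (concat (map uword (butlast ts @ [t]))) < length (concat (map uword ts))"
        by (subst 2(2)) simp
      ultimately have "butlast ts @ [t] = butlast us @ [t']"
        by (intro less.hyps[OF lt]) (use u(2) full_ts full_us in auto)
      then show ?thesis using 2(1) u(1) by simp
    next
      case (3 vs)
      with ne(2) less.prems(3) obtain vs' where u: "us = butlast us @ [Node vs']"
        "concat (map uword (butlast ts @ vs)) = concat (map uword (butlast us @ vs'))"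
        by (cases us rule: uword_last_cases) auto
      have f: "full k (Node vs)" "full k (Node vs')"
        using less.prems(1,2) 3(1) u(1) by (metis in_set_conv_decomp)+
      moreover have lt: "length (concat (map uword (butlast ts @ vs))) < length (concat (map uword ts))"
        by (subst 3(2)) simp
      ultimately have "butlast ts @ vs = butlast us @ vs'"
        by (intro less.hyps[OF lt]) (use u(2) full_ts full_us in auto)
      moreover have "length vs = length vs'" using f by simp
      ultimately show ?thesis using 3(1) u(1) by simp
    qed
  qed
qed

lemma inj_on_word: "inj_on word {t. full k t}"
proof (rule inj_onI)
  fix t t' assume "t \<in> {t. full k t}" "t' \<in> {t. full k t}" "word t = word t'"
  then have "[t] = [t']"
    by (intro concat_uword_inj[of _ k]) (auto simp: uword_eq_Cons_word)
  then show "t = t'" by simp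
qed

section \<open>Heights\<close>

lemma height_0 [simp]: "height k P 0 = 0"
  by (simp add: height_def vertex_def)

lemma height_append [simp]: "i \<le> length P \<Longrightarrow> height k (P @ Q) i = height k P i"
  by (simp add: height_def vertex_def)

lemma height_snoc [simp]:
  "height k (P @ [s]) (Suc (length P)) = height k P (length P) + snd (step_vec k s)"
  by (simp add: height_def vertex_def)

lemma fst_vertex_nonneg: "0 \<le> fst (vertex k P i)"
proof -
  have "0 \<le> fst (step_vec k s)" for s by (cases s) auto
  then have "0 \<le> fst (sum_list (map (step_vec k) Q))" for Q
    by (induction Q) auto
  then show ?thesis by (simp add: vertex_def)
qed

lemma is_path_iff:
  "is_path k A c P \<longleftrightarrow> set P \<subseteq> steps A c \<and> height k P (length P) = 0 \<and>
     (\<forall>i\<le>length P. 0 \<le> height k P i)"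
  by (auto simp: is_path_def fst_vertex_nonneg height_def)

lemma height_flat:
  assumes "ts \<noteq> []" and "\<forall>t\<in>set ts. full k t"
  shows "height k (flat ts) (length (flat ts)) = int (length ts) - 1 \<and>
         (\<forall>i\<le>length (flat ts). 0 \<le> height k (flat ts) i)"
  using assms
proof (induction rule: full_stack_induct)
  case (node ts us)
  moreover have "us \<noteq> []" using node by auto
  ultimately show ?case by (auto simp: flat_node le_Suc_eq)
qed (auto simp: flat_single flat_push flat_level le_Suc_eq)

text \<open>Nonnegativity of the heights guarantees that at least \<open>k + 1\<close> trees are available whenever a
down-step is read.\<close>

lemma flat_surj:
  assumes "\<forall>i\<le>length P. 0 \<le> height k P i"
  shows "\<exists>ts. ts \<noteq> [] \<and> (\<forall>t\<in>set ts. full k t) \<and> flat ts = P"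
  using assms
proof (induction P rule: rev_induct)
  case Nil
  show ?case by (intro exI[of _ "[Empty]"]) (simp add: flat_single)
next
  case (snoc s P)
  have "\<forall>i\<le>length P. 0 \<le> height k P i"
  proof (intro allI impI)
    fix i assume "i \<le> length P"
    then show "0 \<le> height k P i" using snoc.prems[rule_format, of i] by simp
  qed
  with snoc.IH obtain ts where ts: "ts \<noteq> []" "\<forall>t\<in>set ts. full k t" "flat ts = P" by blast
  have h: "0 \<le> height k P (length P) + snd (step_vec k s)"
    using snoc.prems[rule_format, of "Suc (length P)"] by simp
  show ?case
  proof (cases s)
    case U
    with ts show ?thesis by (intro exI[of _ "ts @ [Empty]"]) (auto simp: flat_push)
  next
    case (L a b)
    have "flat (butlast ts @ [Level (last ts) a b]) = P @ [s]"
      using ts L by (simp add: flat_level)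
    moreover have "\<forall>t\<in>set (butlast ts @ [Level (last ts) a b]). full k t"
      using ts by (auto dest: in_set_butlastD)
    ultimately show ?thesis by blast
  next
    case D
    define m where "m = length ts - Suc k"
    have len: "Suc k \<le> length ts"
      using h D height_flat[OF ts(1,2)] ts(3) by simp
    then have "drop m ts \<noteq> []" by (simp add: m_def)
    then have "flat (take m ts @ [Node (drop m ts)]) = P @ [s]"
      using ts D by (simp add: flat_node)
    moreover have "\<forall>t\<in>set (take m ts @ [Node (drop m ts)]). full k t"
      using ts(2) len by (auto simp: m_def dest: in_set_takeD in_set_dropD)
    ultimately show ?thesis by blast
  qed
qed

lemma word_bij_betw:
  "bij_betw word {t. full k t \<and> set (word t) \<subseteq> steps A c \<and> path_len (word t) = n} (paths k A c n)"
proof (rule bij_betw_imageI)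
  show "inj_on word {t. full k t \<and> set (word t) \<subseteq> steps A c \<and> path_len (word t) = n}"
    by (rule inj_on_subset[OF inj_on_word]) auto
next
  show "word ` {t. full k t \<and> set (word t) \<subseteq> steps A c \<and> path_len (word t) = n} = paths k A c n"
  proof (intro equalityI subsetI)
    fix P assume "P \<in> paths k A c n"
    then have P: "set P \<subseteq> steps A c" "height k P (length P) = 0" "path_len P = n"
      "\<forall>i\<le>length P. 0 \<le> height k P i"
      by (auto simp: paths_def is_path_iff)
    from flat_surj[OF P(4)] obtain ts where ts: "ts \<noteq> []" "\<forall>t\<in>set ts. full k t" "flat ts = P"
      by blast
    have "length ts = 1" using height_flat[OF ts(1,2)] P(2) ts(3) by simp
    then obtain t where "ts = [t]" by (auto simp: length_Suc_conv)
    then show "P \<in> word ` {t. full k t \<and> set (word t) \<subseteq> steps A c \<and> path_len (word t) = n}"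
      using ts P by (auto simp: word_def)
  next
    fix P assume "P \<in> word ` {t. full k t \<and> set (word t) \<subseteq> steps A c \<and> path_len (word t) = n}"
    then obtain t where "full k t" "P = word t" "set P \<subseteq> steps A c" "path_len P = n" by auto
    then show "P \<in> paths k A c n"
      using height_flat[of "[t]" k] by (auto simp: paths_def is_path_iff word_def)
  qed
qed

section \<open>Rotations and the statistics of a tree\<close>

text \<open>The cyclic shift by \<open>h\<close> of the residues \<open>0, \<dots>, k - 1\<close>; the label \<open>k\<close>, which stands for weak double
descents, is fixed.\<close>

definition rot :: "nat \<Rightarrow> nat \<Rightarrow> nat \<Rightarrow> nat" where
  "rot k h i = (if i < k then (h + i) mod k else i)"

lemma rot_0 [simp]: "rot k 0 = id"
  by (auto simp: rot_def)

lemma rot_rot: "rot k g \<circ> rot k h = rot k (g + h)"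
  by (auto simp: rot_def fun_eq_iff mod_simps ac_simps)

lemma rot_permutes: "rot k h permutes {0..k}"
proof (cases "k = 0")
  case True
  then have "rot k h = id" by (auto simp: rot_def)
  then show ?thesis by (simp add: permutes_id)
next
  case False
  define g where "g = k * h - h"
  have "g + h = k * h" using False by (cases k) (auto simp: g_def)
  moreover have "rot k (k * h) = id" by (auto simp: rot_def)
  ultimately have "rot k g \<circ> rot k h = id" "rot k h \<circ> rot k g = id"
    by (simp_all add: rot_rot add.commute)
  then have "bij (rot k h)" by (rule o_bij)
  then show ?thesis by (auto simp: permutes_def bij_iff rot_def)
qed

text \<open>The statistic with label \<open>j\<close>, where \<open>p i\<close> is the label that the whole tree assigns to its \<open>i\<close>-th
coordinate. Passing to the child at position \<open>i\<close> raises heights by \<open>i\<close> and so composes \<open>p\<close> with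
\<open>rot k i\<close>. The vector of the path itself is obtained for \<open>p = id\<close>, that of the path raised
by \<open>h\<close> for \<open>p = rot k h\<close>.\<close>

function tstat :: "nat \<Rightarrow> (nat \<Rightarrow> nat) \<Rightarrow> nat \<Rightarrow> ptree \<Rightarrow> nat" where
  "tstat k p j Empty = 0"
| "tstat k p j (Level t a b) = tstat k p j t"
| "tstat k p j (Node ts) =
     (\<Sum>i<length ts. tstat k (p \<circ> rot k i) j (ts ! i) + of_bool (ts ! i \<noteq> Empty \<and> p i = j))"
  by pat_completeness auto
termination
  by (relation "measure (\<lambda>(k, p, j, t). size t)")
     (auto simp: less_Suc_eq_le intro!: size_list_estimation')

text \<open>The bijection \<open>\<Phi>\<^sub>p\<close>: position \<open>i\<close> receives the transformed child from position \<open>inv p i\<close>. For full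
trees and \<open>p permutes {0..k}\<close> that position exists; the value \<open>Empty\<close> otherwise only serves to
make the recursion terminate.\<close>

function perm_tree :: "nat \<Rightarrow> (nat \<Rightarrow> nat) \<Rightarrow> ptree \<Rightarrow> ptree" where
  "perm_tree k p Empty = Empty"
| "perm_tree k p (Level t a b) = Level (perm_tree k p t) a b"
| "perm_tree k p (Node ts) =
     Node (map (\<lambda>i. let j = inv p i in if j < length ts
        then perm_tree k (inv (rot k i) \<circ> p \<circ> rot k j) (ts ! j) else Empty) [0..<length ts])"
  by pat_completeness auto
termination
  by (relation "measure (\<lambda>(k, p, t). size t)")
     (auto simp: less_Suc_eq_le intro!: size_list_estimation')


lemma tstat_comp: "inj q \<Longrightarrow> tstat k (q \<circ> p) (q j) t = tstat k p j t"
proof (induction t arbitrary: p)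
  case (Node ts)
  have "tstat k (q \<circ> p \<circ> rot k i) (q j) (ts ! i) = tstat k (p \<circ> rot k i) j (ts ! i)"
    if "i < length ts" for i
    using Node.IH[of "ts ! i" "p \<circ> rot k i"] Node.prems that by (simp add: o_def)
  then show ?case
    using Node.prems by (auto intro!: sum.cong simp: inj_eq o_def)
qed auto

lemma perm_tree_eq_Empty [simp]: "perm_tree k p t = Empty \<longleftrightarrow> t = Empty"
  by (cases t) auto

lemma perm_tree_Node:
  assumes "length ts = Suc k" and p: "p permutes {0..k}"
  obtains us where "perm_tree k p (Node ts) = Node us" and "length us = Suc k"
    and "\<And>i. i < Suc k \<Longrightarrow> us ! p i = perm_tree k (inv (rot k (p i)) \<circ> p \<circ> rot k i) (ts ! i)"
proof -
  have "p i < Suc k" "inv p (p i) = i" if "i < Suc k" for i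
    using that permutes_in_image[OF p, of i] permutes_inverses[OF p] by auto
  then show ?thesis
    using assms(1) that by (simp add: Let_def del: upt_Suc)
qed

lemma conj_rot_permutes:
  assumes "p permutes {0..k}"
  shows "inv (rot k a) \<circ> p \<circ> rot k b permutes {0..k}"
  by (intro permutes_compose permutes_inv rot_permutes assms)

lemma sum_permute_lessThan:
  assumes "p permutes {0..k}"
  shows "(\<Sum>i<Suc k. f i) = (\<Sum>i<Suc k. f (p i))"
  using sum.permute[OF assms, of f] by (simp add: atLeast0AtMost lessThan_Suc_atMost comp_def)

lemma all_permute_lessThan:
  assumes "p permutes {0..k}" and "\<And>i. i < Suc k \<Longrightarrow> Q (p i)" and "i < Suc k"
  shows "Q i"
proof -
  have "inv p i < Suc k"
    using assms(3) permutes_in_image[OF permutes_inv[OF assms(1)], of i] by auto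
  then show ?thesis
    using assms(2)[of "inv p i"] permutes_inverses[OF assms(1)] by simp
qed

text \<open>The rotation of the new position and the inverse rotation in the recursive permutation cancel,
which leaves exactly the rotation of the old position.\<close>

lemma tstat_perm_tree:
  assumes "full k t" and "p permutes {0..k}"
  shows "tstat k q j (perm_tree k p t) = tstat k (q \<circ> p) j t"
  using assms
proof (induction t arbitrary: p q)
  case (Node ts)
  have len: "length ts = Suc k" using Node.prems by simp
  obtain us where us: "perm_tree k p (Node ts) = Node us" "length us = Suc k"
    "\<And>i. i < Suc k \<Longrightarrow> us ! p i = perm_tree k (inv (rot k (p i)) \<circ> p \<circ> rot k i) (ts ! i)"
    by (rule perm_tree_Node[OF len Node.prems(2)]) blast
  have "tstat k q j (perm_tree k p (Node ts)) =
      (\<Sum>i<Suc k. tstat k (q \<circ> rot k (p i)) j (us ! p i) + of_bool (us ! p i \<noteq> Empty \<and> q (p i) = j))"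
    unfolding us(1) tstat.simps us(2) by (rule sum_permute_lessThan[OF Node.prems(2)])
  also have "\<dots> = (\<Sum>i<Suc k. tstat k (q \<circ> p \<circ> rot k i) j (ts ! i) +
      of_bool (ts ! i \<noteq> Empty \<and> (q \<circ> p) i = j))"
  proof (intro sum.cong refl)
    fix i assume i: "i \<in> {..<Suc k}"
    have "tstat k (q \<circ> rot k (p i)) j (us ! p i) =
        tstat k (q \<circ> rot k (p i) \<circ> (inv (rot k (p i)) \<circ> p \<circ> rot k i)) j (ts ! i)"
      using i us(3)[of i] len Node.prems
      by (auto intro!: Node.IH conj_rot_permutes)
    also have "q \<circ> rot k (p i) \<circ> (inv (rot k (p i)) \<circ> p \<circ> rot k i) = q \<circ> p \<circ> rot k i"
      using permutes_inverses(1)[OF rot_permutes[of k "p i"]] by (auto simp: fun_eq_iff)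
    finally show "tstat k (q \<circ> rot k (p i)) j (us ! p i) + of_bool (us ! p i \<noteq> Empty \<and> q (p i) = j) =
        tstat k (q \<circ> p \<circ> rot k i) j (ts ! i) + of_bool (ts ! i \<noteq> Empty \<and> (q \<circ> p) i = j)"
      using i us(3)[of i] by (simp add: o_def)
  qed
  finally show ?case unfolding tstat.simps len .
qed auto

lemma full_perm_tree:
  assumes "full k t" and "p permutes {0..k}"
  shows "full k (perm_tree k p t)"
  using assms
proof (induction t arbitrary: p)
  case (Node ts)
  have len: "length ts = Suc k" using Node.prems by simp
  obtain us where us: "perm_tree k p (Node ts) = Node us" "length us = Suc k"
    "\<And>i. i < Suc k \<Longrightarrow> us ! p i = perm_tree k (inv (rot k (p i)) \<circ> p \<circ> rot k i) (ts ! i)"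
    by (rule perm_tree_Node[OF len Node.prems(2)]) blast
  have "full k (us ! p i)" if "i < Suc k" for i
    using that us(3)[of i] len Node.prems by (auto intro!: Node.IH conj_rot_permutes)
  then have "full k (us ! i)" if "i < Suc k" for i
    using all_permute_lessThan[OF Node.prems(2), of "\<lambda>i. full k (us ! i)"] that by blast
  then show ?case unfolding us(1) using us(2) by (auto simp: in_set_conv_nth)
qed auto

lemma mset_uword_Node: "mset (uword (Node ts)) = (\<Sum>i<length ts. mset (uword (ts ! i))) + {#D#}"
  by (simp add: mset_concat sum_list_sum_nth atLeast0LessThan)

lemma mset_uword_perm_tree:
  assumes "full k t" and "p permutes {0..k}"
  shows "mset (uword (perm_tree k p t)) = mset (uword t)"
  using assms
proof (induction t arbitrary: p)
  case (Node ts)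
  have len: "length ts = Suc k" using Node.prems by simp
  obtain us where us: "perm_tree k p (Node ts) = Node us" "length us = Suc k"
    "\<And>i. i < Suc k \<Longrightarrow> us ! p i = perm_tree k (inv (rot k (p i)) \<circ> p \<circ> rot k i) (ts ! i)"
    by (rule perm_tree_Node[OF len Node.prems(2)]) blast
  have "(\<Sum>i<Suc k. mset (uword (us ! i))) = (\<Sum>i<Suc k. mset (uword (us ! p i)))"
    by (rule sum_permute_lessThan[OF Node.prems(2)])
  also have "\<dots> = (\<Sum>i<Suc k. mset (uword (ts ! i)))"
    using us(3) len Node.prems by (intro sum.cong refl) (auto intro!: Node.IH conj_rot_permutes)
  finally show ?case unfolding us(1) mset_uword_Node us(2) len by simp
qed auto

lemma perm_tree_inverse:
  assumes "full k t" and "p permutes {0..k}"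
  shows "perm_tree k (inv p) (perm_tree k p t) = t"
  using assms
proof (induction t arbitrary: p)
  case (Node ts)
  have len: "length ts = Suc k" using Node.prems by simp
  obtain us where us: "perm_tree k p (Node ts) = Node us" "length us = Suc k"
    "\<And>i. i < Suc k \<Longrightarrow> us ! p i = perm_tree k (inv (rot k (p i)) \<circ> p \<circ> rot k i) (ts ! i)"
    by (rule perm_tree_Node[OF len Node.prems(2)]) blast
  obtain vs where vs: "perm_tree k (inv p) (Node us) = Node vs" "length vs = Suc k"
    "\<And>i. i < Suc k \<Longrightarrow>
       vs ! inv p i = perm_tree k (inv (rot k (inv p i)) \<circ> inv p \<circ> rot k i) (us ! i)"
    by (rule perm_tree_Node[OF us(2) permutes_inv[OF Node.prems(2)]]) blast
  have "vs ! i = ts ! i" if i: "i < Suc k" for i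
  proof -
    define q where "q = inv (rot k (p i)) \<circ> p \<circ> rot k i"
    have "inv q = inv (rot k i) \<circ> inv p \<circ> rot k (p i)"
      using permutes_bij[OF rot_permutes] permutes_bij[OF Node.prems(2)]
      by (simp add: q_def o_inv_distrib bij_comp bij_imp_bij_inv inv_inv_eq comp_assoc)
    moreover have "p i < Suc k"
      using i permutes_in_image[OF Node.prems(2), of i] by simp
    ultimately have "vs ! i = perm_tree k (inv q) (perm_tree k q (ts ! i))"
      using vs(3)[of "p i"] us(3)[OF i] permutes_inverses[OF Node.prems(2)] by (simp add: q_def)
    also have "\<dots> = ts ! i"
      unfolding q_def using i len Node.prems by (intro Node.IH conj_rot_permutes) auto
    finally show ?thesis .
  qed
  then show ?case unfolding us(1) vs(1) using vs(2) len by (simp add: list_eq_iff_nth_eq)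
qed auto

section \<open>The statistics of a path in terms of its tree\<close>

text \<open>In terms of the path with an extra initial up-step, a weak peak is any step other than \<open>U\<close> that is
preceded by \<open>U\<close>, except for a down-step at the very beginning.\<close>

lemma mem_weak_peaks:
  "j \<in> weak_peaks P \<longleftrightarrow>
    j < length P \<and> P ! j \<noteq> U \<and> (U # P) ! j = U \<and> (j = 0 \<longrightarrow> P ! j \<noteq> D)"
proof -
  have level: "is_level s \<longleftrightarrow> s \<noteq> U \<and> s \<noteq> D" "s = D \<or> is_level s \<longleftrightarrow> s \<noteq> U" for s
    by (cases s; simp)+
  show ?thesis
  proof (cases j)
    case 0
    then show ?thesis by (cases P) (simp_all add: weak_peaks_def level(1))
  next
    case (Suc i)
    then show ?thesis by (simp add: weak_peaks_def level(2)) blast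
  qed
qed

lemma weak_peaks_less: "j \<in> weak_peaks P \<Longrightarrow> j < length P"
  by (simp add: mem_weak_peaks)

lemma finite_weak_peaks [simp]: "finite (weak_peaks P)"
  by (rule finite_subset[of _ "{..<length P}"]) (auto dest: weak_peaks_less)

lemma weak_peaks_snoc:
  assumes "P \<noteq> [] \<or> s \<noteq> D"
  shows "weak_peaks (P @ [s]) =
    weak_peaks P \<union> (if s \<noteq> U \<and> last (U # P) = U then {length P} else {})"
proof (rule set_eqI)
  fix j
  have last: "last (U # P) = (U # P) ! length P"
    by (subst last_conv_nth) auto
  consider "j < length P" | "j = length P" | "j > length P" by linarith
  then show "j \<in> weak_peaks (P @ [s]) \<longleftrightarrow>
    j \<in> weak_peaks P \<union> (if s \<noteq> U \<and> last (U # P) = U then {length P} else {})"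
  proof cases
    case 1
    then have "(U # P @ [s]) ! j = (U # P) ! j" by (cases j) (auto simp: nth_append)
    with 1 show ?thesis by (auto simp: mem_weak_peaks nth_append)
  next
    case 2
    then have "(U # P @ [s]) ! j = last (U # P)"
      unfolding last by (cases P rule: rev_cases) (auto simp: nth_append)
    with 2 assms show ?thesis by (auto simp: mem_weak_peaks)
  next
    case 3
    then show ?thesis by (auto simp: mem_weak_peaks)
  qed
qed

lemma wdd_snoc: "wdd (P @ [s]) = wdd P + of_bool (s = D \<and> last (U # P) \<noteq> U)"
proof (cases P rule: rev_cases)
  case Nil
  then show ?thesis by (simp add: wdd_def)
next
  case (snoc Q x)
  let ?S = "\<lambda>P. {i. Suc i < length P \<and> (P ! i = D \<or> is_level (P ! i)) \<and> P ! Suc i = D}"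
  have x: "x = D \<or> is_level x \<longleftrightarrow> x \<noteq> U" by (cases x) auto
  have "?S (P @ [s]) = ?S P \<union> (if s = D \<and> x \<noteq> U then {length Q} else {})"
  proof (rule set_eqI)
    fix i
    consider "i < length Q" | "i = length Q" | "i > length Q" by linarith
    then show "i \<in> ?S (P @ [s]) \<longleftrightarrow> i \<in> ?S P \<union> (if s = D \<and> x \<noteq> U then {length Q} else {})"
      by cases (auto simp: snoc nth_append x)
  qed
  moreover have "finite (?S P)" by (rule finite_subset[of _ "{..<length P}"]) auto
  moreover have "length Q \<notin> ?S P" using snoc by simp
  ultimately show ?thesis using snoc by (simp add: wdd_def)
qed

text \<open>The number of all weak peaks with height congruent to \<open>i\<close>, the rightmost one included.\<close>

definition peak_count :: "nat \<Rightarrow> nat \<Rightarrow> step list \<Rightarrow> nat" where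
  "peak_count k i P = card {j \<in> weak_peaks P. [height k P j = int i] (mod int k)}"

lemma peak_count_snoc:
  assumes "P \<noteq> [] \<or> s \<noteq> D"
  shows "peak_count k i (P @ [s]) = peak_count k i P +
    of_bool (s \<noteq> U \<and> last (U # P) = U \<and> [height k P (length P) = int i] (mod int k))"
proof -
  let ?C = "\<lambda>j. [height k P j = int i] (mod int k)"
  have "{j \<in> weak_peaks (P @ [s]). [height k (P @ [s]) j = int i] (mod int k)} =
      {j \<in> weak_peaks (P @ [s]). ?C j}"
    by (rule Collect_cong, rule conj_cong) (auto dest: weak_peaks_less)
  also have "\<dots> = {j \<in> weak_peaks P. ?C j} \<union>
      (if s \<noteq> U \<and> last (U # P) = U \<and> ?C (length P) then {length P} else {})"
    unfolding weak_peaks_snoc[OF assms] by (simp del: last.simps) blast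
  moreover have "length P \<notin> weak_peaks P"
    using weak_peaks_less by blast
  ultimately show ?thesis by (simp add: peak_count_def del: last.simps)
qed

lemma cong_int_mod: "j < k \<Longrightarrow> [int m = int j] (mod int k) \<longleftrightarrow> m mod k = j"
  unfolding cong_int_iff by (simp add: cong_def)

lemma sum_nth_append:
  "(\<Sum>i<length (ts @ us). f i ((ts @ us) ! i)) =
   (\<Sum>i<length ts. f i (ts ! i)) + (\<Sum>i<length us. f (length ts + i) (us ! i))"
  for f :: "nat \<Rightarrow> 'a \<Rightarrow> nat"
proof (induction us rule: rev_induct)
  case (snoc u us)
  have "(\<Sum>i<length (ts @ us). f i ((ts @ us @ [u]) ! i)) =
      (\<Sum>i<length (ts @ us). f i ((ts @ us) ! i))"
    unfolding append_assoc [symmetric]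
    by (intro sum.cong refl) (simp add: nth_append [of "ts @ us"] del: append_assoc)
  moreover have "(\<Sum>i<length us. f (length ts + i) ((us @ [u]) ! i)) =
      (\<Sum>i<length us. f (length ts + i) (us ! i))"
    by (intro sum.cong refl) (simp add: nth_append)
  ultimately show ?case using snoc by (simp add: nth_append)
qed (auto intro!: sum.cong simp: nth_append)

lemma wdd_flat:
  assumes "ts \<noteq> []" and "\<forall>t\<in>set ts. full k t"
  shows "wdd (flat ts) = (\<Sum>i<length ts. tstat k (rot k i) k (ts ! i))"
  using assms
proof (induction rule: full_stack_induct)
  case single
  then show ?case by (simp add: flat_single wdd_def)
next
  case (push ts)
  then show ?case
    by (simp add: flat_push wdd_snoc sum_nth_append[where f = "\<lambda>i. tstat k (rot k i) k"]
        del: length_append)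
next
  case (level ts t a b)
  then show ?case
    by (simp add: flat_level wdd_snoc sum_nth_append[where f = "\<lambda>i. tstat k (rot k i) k"]
        del: length_append)
next
  case (node ts us)
  have "us \<noteq> []" using node(2) by auto
  then have us: "us \<noteq> []" "last us = us ! k" using node(2) by (simp_all add: last_conv_nth)
  have "wdd (flat (ts @ [Node us])) =
      (\<Sum>i<length ts. tstat k (rot k i) k (ts ! i)) +
      ((\<Sum>i<Suc k. tstat k (rot k (length ts + i)) k (us ! i)) + of_bool (us ! k \<noteq> Empty))"
    using node us last_flat[of "ts @ us" k]
    by (simp add: flat_node wdd_snoc sum_nth_append[where f = "\<lambda>i. tstat k (rot k i) k"]
        del: length_append sum.lessThan_Suc last.simps)
  also have "(\<Sum>i<Suc k. tstat k (rot k (length ts + i)) k (us ! i)) + of_bool (us ! k \<noteq> Empty) =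
      tstat k (rot k (length ts)) k (Node us)"
  proof -
    have "rot k (length ts) i < k" if "i < k" for i
      using that by (simp add: rot_def)
    then have "(\<Sum>i<k. of_bool (us ! i \<noteq> Empty \<and> rot k (length ts) i = k)) = (0::nat)"
      by (intro sum.neutral) fastforce
    then show ?thesis
      using node(2) by (simp add: rot_rot sum.distrib rot_def[of k _ k])
  qed
  finally show ?case
    by (simp add: sum_nth_append[where f = "\<lambda>i. tstat k (rot k i) k"] del: length_append tstat.simps)
qed

text \<open>Counting all weak peaks, every nonempty tree adds one to its non-rightmost ones, namely its own
rightmost weak peak, whose residue is that of the tree's position.\<close>

lemma peak_count_flat:
  assumes "ts \<noteq> []" and "\<forall>t\<in>set ts. full k t" and j: "j < k"
  shows "peak_count k j (flat ts) =
    (\<Sum>i<length ts. tstat k (rot k i) j (ts ! i) + of_bool (ts ! i \<noteq> Empty \<and> i mod k = j))"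
  using assms(1,2)
proof (induction rule: full_stack_induct)
  case single
  then show ?case by (simp add: flat_single peak_count_def weak_peaks_def)
next
  case (push ts)
  then show ?case
    by (simp add: flat_push peak_count_snoc
        sum_nth_append[where f = "\<lambda>i t. tstat k (rot k i) j t + of_bool (t \<noteq> Empty \<and> i mod k = j)"]
        del: length_append)
next
  case (level ts t a b)
  moreover have "height k (flat (ts @ [t])) (length (flat (ts @ [t]))) = int (length ts)"
    using height_flat[of "ts @ [t]" k] level by simp
  ultimately show ?case
    using last_flat[of "ts @ [t]" k]
    by (simp add: flat_level peak_count_snoc cong_int_mod[OF j]
        sum_nth_append[where f = "\<lambda>i t. tstat k (rot k i) j t + of_bool (t \<noteq> Empty \<and> i mod k = j)"]
        del: length_append last.simps)
next
  case (node ts us)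
  let ?m = "length ts"
  have "us \<noteq> []" using node(2) by auto
  then have us: "us \<noteq> []" "last us = us ! k" using node(2) by (simp_all add: last_conv_nth)
  have h: "height k (flat (ts @ us)) (length (flat (ts @ us))) = int (?m + k)"
    using height_flat[of "ts @ us" k] node us by simp
  then have "flat (ts @ us) \<noteq> []" using j by auto
  then have "peak_count k j (flat (ts @ [Node us])) =
      (\<Sum>i<?m. tstat k (rot k i) j (ts ! i) + of_bool (ts ! i \<noteq> Empty \<and> i mod k = j)) +
      ((\<Sum>i<Suc k. tstat k (rot k (?m + i)) j (us ! i) +
          of_bool (us ! i \<noteq> Empty \<and> (?m + i) mod k = j)) +
        of_bool (us ! k = Empty \<and> ?m mod k = j))"
    using node us last_flat[of "ts @ us" k] h cong_int_mod[OF j, of "?m + k"]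
    by (simp add: flat_node peak_count_snoc
        sum_nth_append[where f = "\<lambda>i t. tstat k (rot k i) j t + of_bool (t \<noteq> Empty \<and> i mod k = j)"]
        del: length_append sum.lessThan_Suc last.simps of_nat_add)
  \<comment> \<open>Only the last summands differ: before joining, \<open>us ! k\<close> if nonempty counts at residue
    \<open>(?m + k) mod k\<close>; in the node it has label \<open>k \<noteq> j\<close>. Together with the new peak for empty
    \<open>us ! k\<close> this always yields one peak at residue \<open>?m mod k\<close>.\<close>
  also have "(\<Sum>i<Suc k. tstat k (rot k (?m + i)) j (us ! i) +
          of_bool (us ! i \<noteq> Empty \<and> (?m + i) mod k = j)) +
        of_bool (us ! k = Empty \<and> ?m mod k = j) =
      tstat k (rot k ?m) j (Node us) + of_bool (?m mod k = j)"
    using node(2) j by (simp add: rot_rot rot_def[of k ?m] del: of_bool_eq_iff)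
  finally show ?case
    by (simp add: sum_nth_append[where f = "\<lambda>i t. tstat k (rot k i) j t + of_bool (t \<noteq> Empty \<and> i mod k = j)"]
        del: length_append tstat.simps)
qed

lemma Max_weak_peaks_snoc:
  assumes "P \<noteq> [] \<or> s \<noteq> D" and "s \<noteq> U" and "last (U # P) \<noteq> U \<Longrightarrow> weak_peaks P \<noteq> {}"
  shows "weak_peaks (P @ [s]) \<noteq> {} \<and> height k (P @ [s]) (Max (weak_peaks (P @ [s]))) =
    (if last (U # P) = U then height k P (length P) else height k P (Max (weak_peaks P)))"
proof (cases "last (U # P) = U")
  case True
  then have W: "weak_peaks (P @ [s]) = insert (length P) (weak_peaks P)"
    using assms(2) by (subst weak_peaks_snoc[OF assms(1)]) simp
  have "Max (insert (length P) (weak_peaks P)) = length P"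
    using weak_peaks_less[of _ P] by (intro Max_eqI) (auto intro: less_imp_le)
  then show ?thesis unfolding W using True by simp
next
  case False
  then have W: "weak_peaks (P @ [s]) = weak_peaks P"
    by (subst weak_peaks_snoc[OF assms(1)]) (simp del: last.simps)
  have "Max (weak_peaks P) < length P"
    using assms(3)[OF False] by (intro weak_peaks_less Max_in finite_weak_peaks)
  then have "height k (P @ [s]) (Max (weak_peaks P)) = height k P (Max (weak_peaks P))"
    by (intro height_append less_imp_le)
  then show ?thesis unfolding W using False assms(3)[OF False] by (simp del: last.simps)
qed

text \<open>A level step or down-step creates no weak peak if the last tree is nonempty, and otherwise
creates one at its own left endpoint. In both cases the rightmost weak peak stays congruent to
the height of the last tree, as joining \<open>k + 1\<close> trees lowers that height by \<open>k\<close>.\<close>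

lemma last_peak_flat:
  assumes "ts \<noteq> []" and "\<forall>t\<in>set ts. full k t" and k: "k \<ge> 1" and "last ts \<noteq> Empty"
  shows "weak_peaks (flat ts) \<noteq> {} \<and>
    [height k (flat ts) (Max (weak_peaks (flat ts))) = int (length ts) - 1] (mod int k)"
  using assms(1,2,4)
proof (induction rule: full_stack_induct)
  case (level ts t a b)
  let ?P = "flat (ts @ [t])"
  have e: "last (U # ?P) = U \<longleftrightarrow> t = Empty"
    using last_flat[of "ts @ [t]" k] level(1) by (simp del: last.simps)
  have h: "height k ?P (length ?P) = int (length ts)"
    using height_flat[of "ts @ [t]" k] level(1) by simp
  have IH: "weak_peaks ?P \<noteq> {}" "[height k ?P (Max (weak_peaks ?P)) = int (length ts)] (mod int k)"
    if "t \<noteq> Empty"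
    using level(2) that by simp_all
  show ?case
    using Max_weak_peaks_snoc[of ?P "L a b" k] e h IH
    by (cases "t = Empty") (simp_all add: flat_level del: last.simps)
next
  case (node ts us)
  let ?P = "flat (ts @ us)"
  have us: "us \<noteq> []" using node(2) by auto
  have e: "last (U # ?P) = U \<longleftrightarrow> last us = Empty"
    using last_flat[of "ts @ us" k] node(1) us by (simp del: last.simps)
  have h: "height k ?P (length ?P) = int (length ts) + int k"
    using height_flat[of "ts @ us" k] node(1,2) us by simp
  then have "?P \<noteq> []" using k by auto
  moreover have IH: "weak_peaks ?P \<noteq> {}"
    "[height k ?P (Max (weak_peaks ?P)) = int (length ts)] (mod int k)" if "last us \<noteq> Empty"
    using node(2,3) us that by (simp_all add: cong_def)
  ultimately show ?case
    using Max_weak_peaks_snoc[of ?P D k] e h us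
    by (cases "last us = Empty") (simp_all add: flat_node cong_def del: last.simps)
qed auto

lemma stat_word:
  assumes "full k t" and "k \<ge> 1" and "i \<le> k"
  shows "stat k i (word t) = tstat k id i t"
proof (cases "i < k")
  case False
  then show ?thesis
    using wdd_flat[of "[t]" k] assms by (simp add: stat_def word_def)
next
  case True
  let ?W = "weak_peaks (word t)"
  let ?C = "{j \<in> ?W. [height k (word t) j = int i] (mod int k)}"
  have pc: "card ?C = tstat k id i t + of_bool (t \<noteq> Empty \<and> i = 0)"
    using peak_count_flat[of "[t]" k i] True assms by (auto simp: peak_count_def word_def)
  show ?thesis
  proof (cases "t = Empty")
    case True
    then show ?thesis
      using \<open>i < k\<close> by (simp add: stat_def wpk_def word_def flat_single weak_peaks_def)
  next
    case False
    then have W: "?W \<noteq> {}" "[height k (word t) (Max ?W) = 0] (mod int k)"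
      using last_peak_flat[of "[t]" k] assms by (simp_all add: word_def)
    have "(\<exists>j'\<in>?W. j < j') \<longleftrightarrow> j \<noteq> Max ?W" if "j \<in> ?W" for j
    proof
      assume "\<exists>j'\<in>?W. j < j'"
      then show "j \<noteq> Max ?W" using Max_ge[OF finite_weak_peaks] by (meson not_le)
    next
      assume "j \<noteq> Max ?W"
      then have "j < Max ?W" using Max_ge[OF finite_weak_peaks that] by simp
      then show "\<exists>j'\<in>?W. j < j'" using Max_in[OF finite_weak_peaks W(1)] by blast
    qed
    then have "{j \<in> ?W. (\<exists>j'\<in>?W. j < j') \<and> [height k (word t) j = int i] (mod int k)} =
        ?C - {Max ?W}"
      by blast
    moreover have "Max ?W \<in> ?C \<longleftrightarrow> i = 0"
    proof -
      have "[height k (word t) (Max ?W) = int i] (mod int k) \<longleftrightarrow> [0 = int i] (mod int k)"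
        using W(2) cong_trans cong_sym by blast
      also have "\<dots> \<longleftrightarrow> i = 0"
        using cong_int_mod[OF True, of 0] by auto
      finally show ?thesis
        using Max_in[OF finite_weak_peaks W(1)] by blast
    qed
    ultimately have "wpk k i (word t) = card ?C - of_bool (i = 0)"
      unfolding wpk_def by (simp only: card_Diff_singleton_if) simp
    then show ?thesis using True False unfolding pc by (simp add: stat_def)
  qed
qed

section \<open>Equidistribution\<close>

lemma perm_tree_word:
  assumes "full k t" and "p permutes {0..k}"
  shows "set (word (perm_tree k p t)) = set (word t)"
    and "path_len (word (perm_tree k p t)) = path_len (word t)"
proof -
  have m: "mset (word (perm_tree k p t)) = mset (word t)"
    using mset_uword_perm_tree[OF assms] uword_eq_Cons_word[OF assms(1)]
      uword_eq_Cons_word[OF full_perm_tree[OF assms]] by simp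
  then show "set (word (perm_tree k p t)) = set (word t)"
    by (rule mset_eq_setD)
  from m have "mset (map step_len (word (perm_tree k p t))) = mset (map step_len (word t))"
    by simp
  then show "path_len (word (perm_tree k p t)) = path_len (word t)"
    unfolding path_len_def by (metis sum_mset_sum_list)
qed

theorem theorem3p1:
  fixes k n :: nat and A :: "nat set" and c :: "nat \<Rightarrow> nat"
    and \<sigma> :: "nat \<Rightarrow> nat" and r :: "nat \<Rightarrow> nat"
  assumes "k \<ge> 1"
    and "\<forall>a\<in>A. a \<ge> 1"
    and "\<forall>a\<ge>1. c a = 0 \<longleftrightarrow> a \<notin> A"
    and "\<sigma> permutes {0..k}"
  shows "card {P \<in> paths k A c n. \<forall>i\<in>{0..k}. stat k i P = r i} =
         card {P \<in> paths k A c n. \<forall>i\<in>{0..k}. stat k (\<sigma> i) P = r i}"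
proof -
  define T where "T = {t. full k t \<and> set (word t) \<subseteq> steps A c \<and> path_len (word t) = n}"
  have card_eq: "card {P \<in> paths k A c n. \<forall>i\<in>{0..k}. stat k (p i) P = r i} =
      card {t \<in> T. \<forall>i\<in>{0..k}. tstat k id (p i) t = r i}" if p: "p permutes {0..k}" for p
  proof -
    have b: "bij_betw word T (paths k A c n)"
      unfolding T_def by (rule word_bij_betw)
    have s: "stat k (p i) (word t) = tstat k id (p i) t" if "t \<in> T" "i \<in> {0..k}" for i t
      using that stat_word[of k t "p i"] assms(1) permutes_in_image[OF p, of i]
      by (simp add: T_def)
    have "bij_betw word {t \<in> T. \<forall>i\<in>{0..k}. tstat k id (p i) t = r i}
        {P \<in> paths k A c n. \<forall>i\<in>{0..k}. stat k (p i) P = r i}"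
    proof (rule bij_betw_imageI)
      show "inj_on word {t \<in> T. \<forall>i\<in>{0..k}. tstat k id (p i) t = r i}"
        by (rule inj_on_subset[OF bij_betw_imp_inj_on[OF b]]) auto
      show "word ` {t \<in> T. \<forall>i\<in>{0..k}. tstat k id (p i) t = r i} =
          {P \<in> paths k A c n. \<forall>i\<in>{0..k}. stat k (p i) P = r i}"
        using s unfolding bij_betw_imp_surj_on[OF b, symmetric] by auto
    qed
    then show ?thesis by (simp add: bij_betw_same_card)
  qed
  have in_T: "perm_tree k p t \<in> T" if "t \<in> T" "p permutes {0..k}" for p t
    using that perm_tree_word[of k t p] full_perm_tree[of k t p] by (simp add: T_def)
  \<comment> \<open>Moving the labels from the tree to the coordinate: \<open>\<Phi>\<^sub>p\<close> carries coordinate \<open>i\<close> to \<open>p i\<close>.\<close>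
  have shift: "tstat k id (p i) (perm_tree k p t) = tstat k id i t"
    if "t \<in> T" "p permutes {0..k}" for p t i
    using that tstat_perm_tree[of k t p id "p i"] tstat_comp[of p k id i t]
      permutes_inj[of p "{0..k}"] by (simp add: T_def)
  have inv_p: "inv \<sigma> permutes {0..k}" "inv (inv \<sigma>) = \<sigma>"
    using assms(4) by (simp_all add: permutes_inv permutes_inv_inv)
  have "bij_betw (perm_tree k \<sigma>) {t \<in> T. \<forall>i\<in>{0..k}. tstat k id i t = r i}
      {t \<in> T. \<forall>i\<in>{0..k}. tstat k id (\<sigma> i) t = r i}"
  proof (rule bij_betw_byWitness[where f' = "perm_tree k (inv \<sigma>)"])
    show "\<forall>t\<in>{t \<in> T. \<forall>i\<in>{0..k}. tstat k id i t = r i}. perm_tree k (inv \<sigma>) (perm_tree k \<sigma> t) = t"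
      using perm_tree_inverse assms(4) by (auto simp: T_def)
    show "\<forall>t\<in>{t \<in> T. \<forall>i\<in>{0..k}. tstat k id (\<sigma> i) t = r i}.
        perm_tree k \<sigma> (perm_tree k (inv \<sigma>) t) = t"
      using perm_tree_inverse[OF _ inv_p(1)] inv_p(2) by (auto simp: T_def)
    show "perm_tree k \<sigma> ` {t \<in> T. \<forall>i\<in>{0..k}. tstat k id i t = r i} \<subseteq>
        {t \<in> T. \<forall>i\<in>{0..k}. tstat k id (\<sigma> i) t = r i}"
      using in_T shift assms(4) by auto
    have "tstat k id i (perm_tree k (inv \<sigma>) t) = tstat k id (\<sigma> i) t" if "t \<in> T" for t i
      using shift[OF that inv_p(1), of "\<sigma> i"] permutes_inverses(2)[OF assms(4)] by simp
    then show "perm_tree k (inv \<sigma>) ` {t \<in> T. \<forall>i\<in>{0..k}. tstat k id (\<sigma> i) t = r i} \<subseteq>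
        {t \<in> T. \<forall>i\<in>{0..k}. tstat k id i t = r i}"
      using in_T inv_p(1) by auto
  qed
  then show ?thesis
    using card_eq[OF permutes_id] card_eq[OF assms(4)] by (simp add: bij_betw_same_card)
qed

end
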